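(* Let $m,n\ge 1$ and let $f=(f_1,f_2,\dots,f_m):\mathbb{R}^n\to\mathbb{R}^m$ be a single-valued mapping. Let $z=(z_1,z_2,\dots,z_n)\in\mathbb{R}^n$. Suppose that for every $i=1,\dots,m$ and every $j=1,\dots,n$ the partial derivative $\frac{\partial f_i}{\partial x_j}(z_1,\dots,z_n)$ exists, and suppose that $f$ has the linear approximation at the point $z$. Then: (a) $f$ is Fréchet differentiable at $z$ and the Fréchet derivative of $f$ at $z$ is the $n\times m$ matrix $$\nabla f(z)=\begin{pmatrix}\frac{\partial f_1}{\partial x_1}(z_1,\dots,z_n)&\cdots&\frac{\partial f_m}{\partial x_1}(z_1,\dots,z_n)\\ \vdots&\ddots&\vdots\\ \frac{\partial f_1}{\partial x_n}(z_1,\dots,z_n)&\cdots&\frac{\partial f_m}{\partial x_n}(z_1,\dots,z_n)\end{pmatrix}.$$ (b) $f$ is Mordukhovich differentiable at $z$, and its Mordukhovich derivative at $z$ is the Jacobian ($m\times n$) matrix of $f$ at $z$: $$\widehat{D}^*f(z)=\nabla f(z)^T=\begin{pmatrix}\frac{\partial f_1}{\partial x_1}(z_1,\dots,z_n)&\cdots&\frac{\partial f_1}{\partial x_n}(z_1,\dots,z_n)\\ \vdots&\ddots&\vdots\\ \frac{\partial f_m}{\partial x_1}(z_1,\dots,z_n)&\cdots&\frac{\partial f_m}{\partial x_n}(z_1,\dots,z_n)\end{pmatrix}.$$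
   Context: $\mathbb{R}^n$ carries the Euclidean norm $\|\cdot\|_n$ and inner product $\langle\cdot,\cdot\rangle$; its elements are row vectors, and an $n\times m$ matrix $A$ represents the linear map $\mathbb{R}^n\to\mathbb{R}^m$, $u\mapsto uA$. $f$ has the linear approximation at $z$ if, for $i=1,\dots,m$, $$\lim_{x\to z}\frac{f_i(x_1,\dots,x_n)-f_i(z_1,\dots,z_n)-\sum_{j=1}^n\frac{\partial f_i}{\partial x_j}(z_1,\dots,z_n)(x_j-z_j)}{\|x-z\|_n}=0.$$ Fréchet derivative: $f$ is Fréchet differentiable at $z$ if there is a continuous linear map $\nabla f(z):\mathbb{R}^n\to\mathbb{R}^m$ with $\lim_{x\to z}\frac{f(x)-f(z)-\nabla f(z)(x-z)}{\|x-z\|_n}=0$. Mordukhovich derivative (coderivative): for $y\in\mathbb{R}^m$, $$\widehat{D}^*f(z)(y)=\Big\{v\in\mathbb{R}^n:\limsup_{(u,f(u))\to(z,f(z))}\frac{\langle v,u-z\rangle-\langle y,f(u)-f(z)\rangle}{\|u-z\|_n+\|f(u)-f(z)\|_m}\le 0\Big\}.$$ $f$ is Mordukhovich differentiable at $z$ if $\widehat{D}^*f(z)(y)\neq\emptyset$ for every $y\in\mathbb{R}^m$. The statement that $\widehat{D}^*f(z)$ equals an $m\times n$ matrix $B$ means $\widehat{D}^*f(z)(y)=\{yB\}$ for every $y\in\mathbb{R}^m$. *)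

theory Defs
  imports "HOL-Analysis.Analysis"
begin

text \<open>
  The dimensions are \<open>n = CARD('n)\<close> and \<open>m = CARD('m)\<close>.  A matrix with \<open>n\<close> rows and \<open>m\<close> columns
  has type \<^typ>\<open>real^'m^'n\<close>; vectors are row vectors, so it acts by \<open>u \<mapsto> u v* A\<close>.
\<close>

definition coord_fun :: "(real^'n \<Rightarrow> real^'m) \<Rightarrow> 'm \<Rightarrow> 'n \<Rightarrow> real^'n \<Rightarrow> real \<Rightarrow> real" where
  "coord_fun f i j z = (\<lambda>t. f (\<chi> k. if k = j then t else z $ k) $ i)"

definition has_partial :: "(real^'n \<Rightarrow> real^'m) \<Rightarrow> 'm \<Rightarrow> 'n \<Rightarrow> real^'n \<Rightarrow> bool" where
  "has_partial f i j z \<longleftrightarrow> coord_fun f i j z differentiable (at (z $ j))"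

definition partial :: "(real^'n \<Rightarrow> real^'m) \<Rightarrow> 'm \<Rightarrow> 'n \<Rightarrow> real^'n \<Rightarrow> real" where
  "partial f i j z = deriv (coord_fun f i j z) (z $ j)"

definition has_linear_approximation :: "(real^'n \<Rightarrow> real^'m) \<Rightarrow> real^'n \<Rightarrow> bool" where
  "has_linear_approximation f z \<longleftrightarrow>
     (\<forall>i. ((\<lambda>x. (f x $ i - f z $ i - (\<Sum>j\<in>UNIV. partial f i j z * (x $ j - z $ j))) / norm (x - z))
            \<longlongrightarrow> 0) (at z))"

text \<open>
  The library's \<^const>\<open>matrix\<close> represents a linear map acting on column vectors by \<open>A *v u\<close>,
  hence the transpose.
\<close>

definition nabla :: "(real^'n \<Rightarrow> real^'m) \<Rightarrow> real^'n \<Rightarrow> real^'m^'n" where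
  "nabla f z = transpose (matrix (frechet_derivative f (at z)))"

lemma nabla_eqI:
  fixes f :: "real^'n \<Rightarrow> real^'m"
  assumes "(f has_derivative (\<lambda>u. u v* A)) (at z)"
  shows "nabla f z = A"
proof -
  have "frechet_derivative f (at z) = (\<lambda>u. u v* A)"
    using frechet_derivative_at[OF assms] by simp
  moreover have "matrix (\<lambda>u. u v* A) = transpose A"
    using matrix_of_matrix_vector_mul[of "transpose A"] by simp
  ultimately show ?thesis
    by (simp add: nabla_def)
qed

text \<open>
  The upper limit along \<open>(u, f u) \<rightarrow> (z, f z)\<close> is taken within the graph of \<open>f\<close>, punctured at
  \<open>(z, f z)\<close>; this forces \<open>f u \<rightarrow> f z\<close> even when \<open>f\<close> is discontinuous at \<open>z\<close>.  It is taken in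
  \<^typ>\<open>ereal\<close> because \<^const>\<open>Limsup\<close> requires a complete lattice.
\<close>

definition coderivative :: "(real^'n \<Rightarrow> real^'m) \<Rightarrow> real^'n \<Rightarrow> real^'m \<Rightarrow> (real^'n) set" where
  "coderivative f z y =
     {v. Limsup (at (z, f z) within range (\<lambda>u. (u, f u)))
           (\<lambda>(u, w). ereal ((v \<bullet> (u - z) - y \<bullet> (w - f z)) / (norm (u - z) + norm (w - f z)))) \<le> 0}"

definition mordukhovich_differentiable :: "(real^'n \<Rightarrow> real^'m) \<Rightarrow> real^'n \<Rightarrow> bool" where
  "mordukhovich_differentiable f z \<longleftrightarrow> (\<forall>y. coderivative f z y \<noteq> {})"

definition coderivative_eq_matrix ::
    "(real^'n \<Rightarrow> real^'m) \<Rightarrow> real^'n \<Rightarrow> real^'n^'m \<Rightarrow> bool" where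
  "coderivative_eq_matrix f z B \<longleftrightarrow> (\<forall>y. coderivative f z y = {y v* B})"

end

theory Submission
  imports Defs
begin

text \<open>
  Linear approximation in each component is Frechet differentiability with the matrix of partial
  derivatives.  Differentiability implies continuity, so the upper limit along the graph becomes an
  upper limit as \<open>u \<rightarrow> z\<close>.  If \<open>v\<close> is the image of \<open>y\<close> under the adjoint of the derivative, the
  linear terms in the numerator cancel and the quotient tends to \<open>0\<close>.  Conversely, along the ray
  \<open>u = z + t h\<close> with \<open>t \<down> 0\<close> the quotient tends to a positive multiple of
  \<open>\<langle>v, h\<rangle> - \<langle>y, D h\<rangle>\<close>, which is therefore nonpositive for both \<open>h\<close> and \<open>- h\<close>.
\<close>

text \<open>On the graph, \<open>fst\<close> inverts \<open>u \<mapsto> (u, f u)\<close> and is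
  itself continuous, so it carries the punctured filter on the graph to \<open>at z\<close>.
  Continuity of \<open>f\<close> enters for the opposite inequality, where
  \<open>u \<rightarrow> z\<close> has to force
  \<open>(u, f u) \<rightarrow> (z, f z)\<close>.\<close>

lemma at_within_graph:
  fixes f :: "'a::t2_space \<Rightarrow> 'b::t2_space"
  assumes "isCont f z"
  shows "at (z, f z) within range (\<lambda>u. (u, f u)) = filtermap (\<lambda>u. (u, f u)) (at z)"
    (is "?F = filtermap ?G _")
proof (rule antisym)
  have fst_lim: "filterlim fst (at z) ?F"
    unfolding filterlim_at
  proof
    show "eventually (\<lambda>p. fst p \<in> UNIV \<and> fst p \<noteq> z) ?F"
      unfolding eventually_at_filter by (rule always_eventually) auto
    show "(fst \<longlongrightarrow> z) ?F"
      using tendsto_fst[OF tendsto_ident_at, of "(z, f z)" "range ?G"] by simp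
  qed
  show "?F \<le> filtermap ?G (at z)"
  proof (rule filter_leI)
    fix P assume "eventually P (filtermap ?G (at z))"
    then have "eventually (\<lambda>u. P (?G u)) (at z)"
      by (simp add: eventually_filtermap)
    then have "eventually (\<lambda>p. P (?G (fst p))) ?F"
      using fst_lim by (rule eventually_compose_filterlim)
    moreover have "eventually (\<lambda>p. p \<in> range ?G) ?F"
      by (simp add: eventually_at_filter)
    ultimately show "eventually P ?F"
      by eventually_elim auto
  qed
  have "filterlim ?G ?F (at z)"
    using assms by (auto simp: filterlim_at isCont_def eventually_at_filter intro!: tendsto_intros)
  then show "filtermap ?G (at z) \<le> ?F"
    by (simp add: filterlim_def)
qed

text \<open>The chain rule along \<open>t \<mapsto> z + t *\<^sub>R h\<close> reduces this to a
  vector derivative in one real variable; from the right \<open>norm t = t\<close>, so the linear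
  term splits off as \<open>D h\<close>.\<close>

lemma has_derivative_tendsto_ray:
  fixes f :: "'a::real_normed_vector \<Rightarrow> 'b::real_normed_vector"
  assumes "(f has_derivative D) (at z)"
  shows "((\<lambda>t. (f (z + t *\<^sub>R h) - f z) /\<^sub>R t) \<longlongrightarrow> D h) (at_right 0)"
proof -
  have "((\<lambda>t. f (z + t *\<^sub>R h)) has_derivative (\<lambda>t. D (t *\<^sub>R h))) (at 0)"
    by (rule has_derivative_compose[of "\<lambda>t. z + t *\<^sub>R h" "\<lambda>t. t *\<^sub>R h" 0 UNIV f D])
       (use assms in \<open>auto intro!: derivative_eq_intros\<close>)
  moreover have "(\<lambda>t. D (t *\<^sub>R h)) = (\<lambda>t. t *\<^sub>R D h)"
    by (simp add: has_derivative_bounded_linear[OF assms] bounded_linear.linear linear_scale)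
  ultimately have "((\<lambda>t. f (z + t *\<^sub>R h)) has_vector_derivative D h) (at 0)"
    by (simp add: has_vector_derivative_def)
  then have "((\<lambda>t. (f (z + t *\<^sub>R h) - f z - t *\<^sub>R D h) /\<^sub>R norm t) \<longlongrightarrow> 0) (at_right 0)"
    using has_vector_derivative_at_within[of _ _ 0 "{0<..}"]
    by (fastforce simp: has_vector_derivative_def has_derivative_at_within)
  moreover have "eventually (\<lambda>t. (f (z + t *\<^sub>R h) - f z - t *\<^sub>R D h) /\<^sub>R norm t
      = (f (z + t *\<^sub>R h) - f z) /\<^sub>R t - D h) (at_right 0)"
    using eventually_at_right_less[of 0]
    by eventually_elim (simp add: scaleR_diff_right)
  ultimately show ?thesis
    by (rule LIM_zero_cancel[OF Lim_transform_eventually])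
qed

lemma coderivative_has_derivative:
  fixes f :: "real^'n \<Rightarrow> real^'m"
  assumes D: "(f has_derivative D) (at z)"
  shows "coderivative f z y = {v. \<forall>h. v \<bullet> h = y \<bullet> D h}"
proof -
  define q where "q v u = (v \<bullet> (u - z) - y \<bullet> (f u - f z)) / (norm (u - z) + norm (f u - f z))" for v u
  have cod: "v \<in> coderivative f z y \<longleftrightarrow> Limsup (at z) (\<lambda>u. ereal (q v u)) \<le> 0" for v
    using has_derivative_continuous[OF D]
    by (simp add: coderivative_def at_within_graph continuous_within isCont_def Limsup_filtermap_eq inj_def q_def)
  show ?thesis
  proof (intro set_eqI iffI)
    fix v assume "v \<in> {v. \<forall>h. v \<bullet> h = y \<bullet> D h}"
    then have v: "v \<bullet> h = y \<bullet> D h" for h by simp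
    let ?r = "\<lambda>u. (f u - f z - D (u - z)) /\<^sub>R norm (u - z)"
    have "(?r \<longlongrightarrow> 0) (at z)"
      using D by (simp add: has_derivative_at_within)
    then have "((\<lambda>u. norm y * norm (?r u)) \<longlongrightarrow> 0) (at z)"
      by (intro tendsto_mult_right_zero tendsto_norm_zero)
    moreover have "norm (q v u) \<le> norm y * norm (?r u)" if "u \<noteq> z" for u
    proof -
      have "v \<bullet> (u - z) - y \<bullet> (f u - f z) = - (y \<bullet> (f u - f z - D (u - z)))"
        unfolding v by (simp add: inner_diff_right)
      then have "\<bar>v \<bullet> (u - z) - y \<bullet> (f u - f z)\<bar> \<le> norm y * norm (f u - f z - D (u - z))"
        using Cauchy_Schwarz_ineq2[of y "f u - f z - D (u - z)"] by simp
      \<comment> \<open>Dropping \<open>norm (f u - f z)\<close> from the denominator can only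
        enlarge the bound, and \<open>u \<noteq> z\<close> keeps what remains positive.\<close>
      then have "norm (q v u) \<le> norm y * norm (f u - f z - D (u - z)) / norm (u - z)"
        using that by (simp add: q_def abs_divide frac_le)
      then show ?thesis by (simp add: divide_inverse mult_ac)
    qed
    ultimately have "(q v \<longlongrightarrow> 0) (at z)"
      by (rule_tac Lim_null_comparison) (auto simp: eventually_at_filter)
    then have "((\<lambda>u. ereal (q v u)) \<longlongrightarrow> ereal 0) (at z)"
      by (rule tendsto_ereal)
    then have "Limsup (at z) (\<lambda>u. ereal (q v u)) = 0"
      by (simp add: lim_imp_Limsup zero_ereal_def)
    then show "v \<in> coderivative f z y"
      by (simp add: cod)
  next
    fix v assume v: "v \<in> coderivative f z y"
    have le: "v \<bullet> h \<le> y \<bullet> D h" if "h \<noteq> 0" for h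
    proof -
      \<comment> \<open>For \<open>t > 0\<close>, a factor \<open>t\<close> cancels from the
        numerator and denominator of \<open>q v (z + t *\<^sub>R h)\<close>, leaving an expression
        in \<open>?d t\<close>. Its limit exists because \<open>h \<noteq> 0\<close> makes the
        limiting denominator positive.\<close>
      let ?d = "\<lambda>t. (f (z + t *\<^sub>R h) - f z) /\<^sub>R t"
      have "((\<lambda>t. (v \<bullet> h - y \<bullet> ?d t) / (norm h + norm (?d t)))
              \<longlongrightarrow> (v \<bullet> h - y \<bullet> D h) / (norm h + norm (D h))) (at_right 0)"
        using that has_derivative_tendsto_ray[OF D]
        by (intro tendsto_intros) (auto simp: add_nonneg_eq_0_iff)
      moreover have "eventually (\<lambda>t. (v \<bullet> h - y \<bullet> ?d t) / (norm h + norm (?d t)) = q v (z + t *\<^sub>R h))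
              (at_right 0)"
        using eventually_at_right_less[of 0]
      proof eventually_elim
        case (elim t)
        have "f (z + t *\<^sub>R h) - f z = t *\<^sub>R ?d t"
          using elim by simp
        then have "q v (z + t *\<^sub>R h) = (v \<bullet> (t *\<^sub>R h) - y \<bullet> (t *\<^sub>R ?d t))
            / (norm (t *\<^sub>R h) + norm (t *\<^sub>R ?d t))"
          by (simp only: q_def add_diff_cancel_left')
        also have "\<dots> = (t * (v \<bullet> h - y \<bullet> ?d t)) / (t * (norm h + norm (?d t)))"
          using elim by (simp only: inner_scaleR_right norm_scaleR abs_of_pos right_diff_distrib distrib_left)
        finally show ?case using elim by simp
      qed
      ultimately have lim: "((\<lambda>t. q v (z + t *\<^sub>R h))
              \<longlongrightarrow> (v \<bullet> h - y \<bullet> D h) / (norm h + norm (D h))) (at_right 0)"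
        by (rule Lim_transform_eventually)
      have ray: "filterlim (\<lambda>t. z + t *\<^sub>R h) (at z) (at_right 0)"
        unfolding filterlim_at using that
        by (auto simp: eventually_at_filter intro!: tendsto_eq_intros)
      \<comment> \<open>A nonpositive upper limit says only that \<open>q v\<close> is eventually
        below each \<open>e > 0\<close>; this bound passes to the limit along the ray, and then
        \<open>e\<close> is arbitrary.\<close>
      have "(v \<bullet> h - y \<bullet> D h) / (norm h + norm (D h)) \<le> e" if "e > 0" for e
      proof (rule tendsto_upperbound[OF lim])
        have "eventually (\<lambda>u. ereal (q v u) < ereal e) (at z)"
          using v that unfolding cod Limsup_le_iff by (metis ereal_less(2))
        from eventually_compose_filterlim[OF this ray]
        have "eventually (\<lambda>t. q v (z + t *\<^sub>R h) < e) (at_right 0)"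
          by simp
        then show "eventually (\<lambda>t. q v (z + t *\<^sub>R h) \<le> e) (at_right 0)"
          by eventually_elim simp
      qed simp
      then have "(v \<bullet> h - y \<bullet> D h) / (norm h + norm (D h)) \<le> 0"
        by (meson dense_ge)
      moreover have "norm h + norm (D h) > 0"
        using that by (simp add: add_pos_nonneg)
      ultimately show ?thesis
        by (simp add: divide_le_0_iff)
    qed
    have lin: "linear D"
      using D by (rule has_derivative_linear)
    have "v \<bullet> h = y \<bullet> D h" for h
      using le[of h] le[of "- h"] linear_0[OF lin] linear_neg[OF lin, of h]
      by (cases "h = 0") auto
    then show "v \<in> {v. \<forall>h. v \<bullet> h = y \<bullet> D h}" by simp
  qed
qed

text \<open>Convergence in \<open>real^'m\<close> is componentwise, and component \<open>i\<close>
  of the remainder quotient for this matrix is exactly the quotient in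
  \<open>has_linear_approximation\<close>.\<close>

lemma has_linear_approximation_imp_has_derivative:
  fixes f :: "real^'n \<Rightarrow> real^'m"
  assumes "has_linear_approximation f z"
  shows "(f has_derivative (\<lambda>u. u v* (\<chi> j i. partial f i j z))) (at z)"
  unfolding has_derivative_within
proof
  show "bounded_linear (\<lambda>u. u v* (\<chi> j i. partial f i j z))"
    unfolding transpose_matrix_vector[symmetric] by (rule matrix_vector_mul_bounded_linear)
  show "((\<lambda>x. (1 / norm (x - z)) *\<^sub>R (f x - (f z + (x - z) v* (\<chi> j i. partial f i j z))))
          \<longlongrightarrow> 0) (at z)"
    using assms
    by (intro vec_tendstoI)
       (simp add: has_linear_approximation_def vector_matrix_mult_def diff_diff_eq mult.commute)
qed

theorem theorem3p2:
  fixes f :: "real^'n \<Rightarrow> real^'m" and z :: "real^'n"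
  assumes "\<forall>i j. has_partial f i j z"
    and "has_linear_approximation f z"
  shows "(f differentiable (at z) \<and>
          frechet_derivative f (at z) = (\<lambda>u. u v* nabla f z) \<and>
          nabla f z = (\<chi> j i. partial f i j z)) \<and>
         (mordukhovich_differentiable f z \<and>
          coderivative_eq_matrix f z (transpose (nabla f z)) \<and>
          transpose (nabla f z) = (\<chi> i j. partial f i j z))"
proof -
  note lin_approx = has_linear_approximation_imp_has_derivative[OF assms(2)]
  have nabla: "nabla f z = (\<chi> j i. partial f i j z)"
    by (rule nabla_eqI[OF lin_approx])
  have D: "(f has_derivative (\<lambda>u. u v* nabla f z)) (at z)"
    using lin_approx by (simp add: nabla)
  have cod: "coderivative f z y = {y v* transpose (nabla f z)}" for y
  proof -
    \<comment> \<open>The adjoint of \<open>h \<mapsto> h v* A\<close> is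
      \<open>y \<mapsto> y v* transpose A\<close>. Testing against all \<open>h\<close> then
      determines \<open>v\<close> uniquely, so the coderivative is a singleton and in particular
      nonempty.\<close>
    have "y \<bullet> (h v* nabla f z) = (y v* transpose (nabla f z)) \<bullet> h" for h
      by (metis dot_lmul_matrix inner_commute vector_transpose_matrix)
    then show ?thesis
      by (auto simp: coderivative_has_derivative[OF D] vector_eq_rdot)
  qed
  have "f differentiable (at z)"
    using D by (rule differentiableI)
  moreover have "frechet_derivative f (at z) = (\<lambda>u. u v* nabla f z)"
    using frechet_derivative_at[OF D] by simp
  moreover have "transpose (nabla f z) = (\<chi> i j. partial f i j z)"
    by (simp add: nabla transpose_def)
  ultimately show ?thesis
    using nabla cod by (simp add: mordukhovich_differentiable_def coderivative_eq_matrix_def)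
qed

end
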